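(* Let $X$ be a real convex-transitive Banach space. Suppose that for each $\epsilon>0$ there exist $k\in\mathbb{N}$, numbers $\delta_1,\dots,\delta_k\in(0,1)$, numbers $c_1,\dots,c_k\in(0,1]$ with $\sum_{i=1}^k c_i=1$, and functionals $f_1,\dots,f_k\in S_{X^*}$ such that (1) $\{y\in B_X : f_i(y)>1-c_i\delta_i \text{ for all } 1\le i\le k\}\neq\emptyset$, and (2) $\operatorname{diam}\{y\in B_X : f_i(y)>1-2\delta_i \text{ for all } 1\le i\le k\}<\epsilon$. Then $X\in\mathcal{J}$, i.e. $X$ is almost transitive, uniformly convex and uniformly smooth.
   Context: All spaces are real Banach spaces. $B_X$ is the closed unit ball and $S_X$ the unit sphere. $\mathcal{G}_X$ is the group of surjective linear isometries of $X$; for $x\in S_X$, $\mathcal{G}_X(x)=\{T(x):T\in\mathcal{G}_X\}$. $X$ is almost transitive if $\overline{\mathcal{G}_X(x)}=S_X$ for all $x\in S_X$, and convex-transitive if $\overline{\mathrm{conv}}(\mathcal{G}_X(x))=B_X$ for all $x\in S_X$. $\mathcal{J}$ is the class of Banach spaces that are simultaneously almost transitive, uniformly convex and uniformly smooth. *)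

theory Defs
  imports "HOL-Analysis.Analysis"
begin

definition isometry_group :: "('a::real_normed_vector \<Rightarrow> 'a) set" where
  "isometry_group = {T. linear T \<and> surj T \<and> (\<forall>x. norm (T x) = norm x)}"

definition orbit :: "'a::real_normed_vector \<Rightarrow> 'a set" where
  "orbit x = {T x | T. T \<in> isometry_group}"

definition almost_transitive :: "'a::real_normed_vector itself \<Rightarrow> bool" where
  "almost_transitive _ \<longleftrightarrow> (\<forall>x::'a. norm x = 1 \<longrightarrow> closure (orbit x) = sphere 0 1)"

definition convex_transitive :: "'a::real_normed_vector itself \<Rightarrow> bool" where
  "convex_transitive _ \<longleftrightarrow> (\<forall>x::'a. norm x = 1 \<longrightarrow> closure (convex hull (orbit x)) = cball 0 1)"

definition uniformly_convex :: "'a::real_normed_vector itself \<Rightarrow> bool" where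
  "uniformly_convex _ \<longleftrightarrow> (\<forall>\<epsilon>>0. \<exists>\<delta>>0. \<forall>x y::'a. norm x \<le> 1 \<longrightarrow> norm y \<le> 1 \<longrightarrow>
      norm (x - y) \<ge> \<epsilon> \<longrightarrow> norm ((x + y) /\<^sub>R 2) \<le> 1 - \<delta>)"

definition modulus_smoothness :: "'a::real_normed_vector itself \<Rightarrow> real \<Rightarrow> real" where
  "modulus_smoothness _ \<tau> = (SUP p\<in>{(x::'a, y). norm x = 1 \<and> norm y = 1}.
      (norm (fst p + \<tau> *\<^sub>R snd p) + norm (fst p - \<tau> *\<^sub>R snd p)) / 2 - 1)"

definition uniformly_smooth :: "'a::real_normed_vector itself \<Rightarrow> bool" where
  "uniformly_smooth X \<longleftrightarrow> ((\<lambda>\<tau>. modulus_smoothness X \<tau> / \<tau>) \<longlongrightarrow> 0) (at_right 0)"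

definition class_J :: "'a::real_normed_vector itself \<Rightarrow> bool" where
  "class_J X \<longleftrightarrow> almost_transitive X \<and> uniformly_convex X \<and> uniformly_smooth X"

definition dual_sphere :: "('a::real_normed_vector \<Rightarrow> real) set" where
  "dual_sphere = {f. bounded_linear f \<and> onorm f = 1}"

end

theory Submission
  imports Defs
begin

text \<open>By convex transitivity every orbit in the sphere meets the slice intersection with
  parameters \<open>\<delta> i\<close>, even with slightly smaller ones. Two orbits thus come
  \<open>\<epsilon>\<close>-close inside a set of small diameter, which is almost transitivity. If a midpoint
  of norm close to 1 is moved into the smaller intersection, then both end points lie in the larger
  one with parameters \<open>2 * \<delta> i\<close>, which is uniform convexity.

  For smoothness it suffices, by almost transitivity and convexity in the increment, to find for each
  \<open>c > 0\<close> one point at which the averaged norm increases by less than \<open>c\<close> times the step. If there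
  were none, there would be a dyadic martingale with steps of norm at most 1 whose expected norm grows
  linearly. But uniform convexity makes its second moment grow subquadratically: the two halves of a walk
  of length \<open>2 * n\<close> would have to nearly agree in \<open>L\<^sup>2\<close>, while the second half has conditional mean zero.\<close>

section \<open>The group of surjective linear isometries\<close>

lemma isometry_groupD:
  assumes "T \<in> isometry_group"
  shows "linear T" "surj T" "norm (T x) = norm x"
  using assms by (auto simp: isometry_group_def)

lemma isometry_group_dist:
  assumes "T \<in> isometry_group"
  shows "norm (T x - T y) = norm (x - y)"
  using isometry_groupD[OF assms] by (metis linear_diff)

lemma isometry_group_compose:
  assumes "S \<in> isometry_group" "T \<in> isometry_group"
  shows "S \<circ> T \<in> isometry_group"
  using assms comp_surj[of T S] by (simp add: isometry_group_def linear_compose)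

lemma isometry_group_inverse:
  assumes "T \<in> isometry_group"
  shows "\<exists>S\<in>isometry_group. (\<forall>x. S (T x) = x) \<and> (\<forall>x. T (S x) = x)"
proof -
  have inj: "inj T"
    by (rule injI) (metis assms isometry_group_dist norm_eq_zero right_minus_eq)
  have TS: "T (inv T x) = x" for x
    using isometry_groupD(2)[OF assms] by (simp add: surj_f_inv_f)
  have ST: "inv T (T x) = x" for x
    using inj by simp
  note Tl = isometry_groupD(1)[OF assms]
  have "linear (inv T)"
  proof (rule linearI)
    show "inv T (x + y) = inv T x + inv T y" for x y
      using ST[of "inv T x + inv T y"] by (simp only: linear_add[OF Tl] TS)
    show "inv T (r *\<^sub>R x) = r *\<^sub>R inv T x" for r x
      using ST[of "r *\<^sub>R inv T x"] by (simp only: linear_scale[OF Tl] TS)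
  qed
  moreover have "norm (inv T x) = norm x" for x
    using isometry_groupD(3)[OF assms, of "inv T x"] TS by simp
  moreover have "surj (inv T)"
    using ST by (metis surjI)
  ultimately have "inv T \<in> isometry_group"
    by (auto simp: isometry_group_def)
  with ST TS show ?thesis by blast
qed

section \<open>Norm-one functionals and slices of the unit ball\<close>

lemma dual_sphereD:
  assumes "f \<in> dual_sphere"
  shows "bounded_linear f" "f x \<le> norm x"
proof -
  show bl: "bounded_linear f" using assms by (simp add: dual_sphere_def)
  show "f x \<le> norm x"
    using onorm[OF bl, of x] assms by (auto simp: dual_sphere_def)
qed

text \<open>If an orbit missed the intersection of slices, it would lie in the closed half-space
  on which the sum of the \<open>(1 - f i) / \<alpha> i\<close> is at least 1, and convex transitivity
  would put the whole unit ball there.\<close>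
lemma orbit_meets_slices:
  fixes f :: "'i \<Rightarrow> 'a::real_normed_vector \<Rightarrow> real"
  assumes ct: "convex_transitive TYPE('a)" and "finite I" "I \<noteq> {}"
    and f: "\<And>i. i \<in> I \<Longrightarrow> f i \<in> dual_sphere"
    and \<alpha>: "\<And>i. i \<in> I \<Longrightarrow> 0 < \<alpha> i"
    and c: "sum c I = 1" and y: "norm y \<le> 1" "\<And>i. i \<in> I \<Longrightarrow> f i y > 1 - c i * \<alpha> i"
    and x: "norm x = 1"
  shows "\<exists>T\<in>isometry_group. \<forall>i\<in>I. f i (T x) > 1 - \<alpha> i"
proof (rule ccontr)
  assume neg: "\<not> ?thesis"
  define h where "h v = (\<Sum>i\<in>I. f i v / \<alpha> i)" for v
  define H where "H = {v. h v \<le> (\<Sum>i\<in>I. 1 / \<alpha> i) - 1}"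
  have h: "bounded_linear h"
    unfolding h_def
    by (intro bounded_linear_sum bounded_linear_divide bounded_linear_compose[OF bounded_linear_divide]
        dual_sphereD(1) f)
  have "convex H"
  proof -
    have "H = h -` {..(\<Sum>i\<in>I. 1 / \<alpha> i) - 1}" by (auto simp: H_def)
    then show ?thesis
      using convex_linear_vimage[OF bounded_linear.linear[OF h]] by simp
  qed
  moreover have "closed H"
    unfolding H_def
    by (intro closed_Collect_le continuous_intros linear_continuous_on h)
  moreover have "orbit x \<subseteq> H"
  proof
    fix v assume "v \<in> orbit x"
    then obtain T where T: "T \<in> isometry_group" "v = T x" by (auto simp: orbit_def)
    then obtain j where j: "j \<in> I" "f j v \<le> 1 - \<alpha> j" using neg by force
    \<comment> \<open>Isometries keep \<open>v\<close> on the unit sphere, where every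
      \<open>f i\<close> is at most 1. No summand is negative, so the one failing index
      \<open>j\<close> alone pushes the sum up to 1.\<close>
    have nn: "0 \<le> (1 - f i v) / \<alpha> i" if "i \<in> I" for i
      using dual_sphereD(2)[OF f[OF that], of v] isometry_groupD(3)[OF T(1), of x] x T(2)
        \<alpha>[OF that] by simp
    have "1 \<le> (1 - f j v) / \<alpha> j" using j \<alpha>[of j] by (simp add: field_simps)
    also have "\<dots> \<le> (\<Sum>i\<in>I. (1 - f i v) / \<alpha> i)"
      by (rule member_le_sum) (use j nn \<open>finite I\<close> in auto)
    also have "\<dots> = (\<Sum>i\<in>I. 1 / \<alpha> i) - h v"
      by (simp add: h_def diff_divide_distrib sum_subtractf)
    finally show "v \<in> H" by (simp add: H_def)
  qed
  ultimately have "closure (convex hull (orbit x)) \<subseteq> H"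
    by (meson closure_minimal hull_minimal)
  moreover have "y \<in> closure (convex hull (orbit x))"
    using ct x y(1) by (simp add: convex_transitive_def)
  ultimately have "h y \<le> (\<Sum>i\<in>I. 1 / \<alpha> i) - 1" by (auto simp: H_def)
  \<comment> \<open>Each bound on \<open>f i y\<close> makes the summand smaller than
    \<open>c i\<close>, so \<open>y\<close> misses \<open>H\<close>.\<close>
  moreover have "(\<Sum>i\<in>I. 1 / \<alpha> i) - h y < sum c I"
  proof -
    have "(\<Sum>i\<in>I. 1 / \<alpha> i) - h y = (\<Sum>i\<in>I. (1 - f i y) / \<alpha> i)"
      by (simp add: h_def diff_divide_distrib sum_subtractf)
    also have "\<dots> < sum c I"
    proof (rule sum_strict_mono)
      fix i assume "i \<in> I"
      then show "(1 - f i y) / \<alpha> i < c i"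
        using y(2)[of i] \<alpha>[of i] by (simp add: field_simps)
    qed (use assms in auto)
    finally show ?thesis .
  qed
  ultimately show False using c by simp
qed

text \<open>The margin \<open>g\<close> is what later serves as the modulus of convexity.\<close>
definition slice_transitive :: "'a::real_normed_vector itself \<Rightarrow> bool" where
  "slice_transitive _ \<longleftrightarrow> (\<forall>\<epsilon>>0. \<exists>(I::nat set) (f::nat \<Rightarrow> 'a \<Rightarrow> real) \<alpha> g. 0 < g \<and> g < 1 \<and>
     (\<forall>i\<in>I. f i \<in> dual_sphere \<and> 0 < \<alpha> i \<and> \<alpha> i < 1) \<and>
     (\<forall>x. norm x = 1 \<longrightarrow> (\<exists>T\<in>isometry_group. \<forall>i\<in>I. f i (T x) > 1 - \<alpha> i)) \<and>
     (\<forall>u v. norm u \<le> 1 \<longrightarrow> norm v \<le> 1 \<longrightarrow> (\<forall>i\<in>I. f i u > 1 - 2 * (\<alpha> i + g)) \<longrightarrow>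
        (\<forall>i\<in>I. f i v > 1 - 2 * (\<alpha> i + g)) \<longrightarrow> norm (u - v) < \<epsilon>))"

lemma slice_transitiveE:
  assumes "slice_transitive TYPE('a::real_normed_vector)" "0 < e"
  obtains g I and f :: "nat \<Rightarrow> 'a::real_normed_vector \<Rightarrow> real" and \<alpha> where "0 < g" "g < 1"
    "\<forall>i\<in>I. f i \<in> dual_sphere \<and> 0 < \<alpha> i \<and> \<alpha> i < 1"
    "\<forall>x. norm x = 1 \<longrightarrow> (\<exists>T\<in>isometry_group. \<forall>i\<in>I. f i (T x) > 1 - \<alpha> i)"
    "\<forall>u v. norm u \<le> 1 \<longrightarrow> norm v \<le> 1 \<longrightarrow> (\<forall>i\<in>I. f i u > 1 - 2 * (\<alpha> i + g)) \<longrightarrow>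
        (\<forall>i\<in>I. f i v > 1 - 2 * (\<alpha> i + g)) \<longrightarrow> norm (u - v) < e"
  using assms(1)[unfolded slice_transitive_def, rule_format, OF assms(2)]
  by (elim exE conjE) (rule that)

text \<open>The first condition leaves room: its inequalities are strict, so each
  \<open>\<delta> i\<close> can be lowered to some \<open>\<alpha> i\<close>, and the gap provides
  the margin.\<close>

lemma convex_transitive_imp_slice_transitive:
  assumes ct: "convex_transitive TYPE('a::real_normed_vector)"
    and sl: "\<forall>\<epsilon>>0. \<exists>(k::nat) (\<delta>::nat \<Rightarrow> real) (c::nat \<Rightarrow> real) (f::nat \<Rightarrow> 'a \<Rightarrow> real).
           (\<forall>i\<in>{1..k}. 0 < \<delta> i \<and> \<delta> i < 1 \<and> 0 < c i \<and> c i \<le> 1 \<and> f i \<in> dual_sphere) \<and>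
           (\<Sum>i\<in>{1..k}. c i) = 1 \<and>
           {y \<in> cball 0 1. \<forall>i\<in>{1..k}. f i y > 1 - c i * \<delta> i} \<noteq> {} \<and>
           diameter {y \<in> cball 0 1. \<forall>i\<in>{1..k}. f i y > 1 - 2 * \<delta> i} < \<epsilon>"
  shows "slice_transitive TYPE('a)"
  unfolding slice_transitive_def
proof (intro allI impI)
  fix \<epsilon> :: real assume "0 < \<epsilon>"
  with sl obtain k :: nat and \<delta> c and f :: "nat \<Rightarrow> 'a \<Rightarrow> real" where
    *: "\<And>i. i \<in> {1..k} \<Longrightarrow> 0 < \<delta> i \<and> \<delta> i < 1 \<and> 0 < c i \<and> c i \<le> 1 \<and> f i \<in> dual_sphere"
    and c: "(\<Sum>i\<in>{1..k}. c i) = 1"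
    and ne: "{y \<in> cball 0 1. \<forall>i\<in>{1..k}. f i y > 1 - c i * \<delta> i} \<noteq> {}"
    and dm: "diameter {y::'a \<in> cball 0 1. \<forall>i\<in>{1..k}. f i y > 1 - 2 * \<delta> i} < \<epsilon>"
    by blast
  define I where "I = {1..k}"
  have "k \<noteq> 0" using c by (cases "k = 0") auto
  then have I: "finite I" "I \<noteq> {}" by (auto simp: I_def)
  from ne obtain y where y: "norm y \<le> 1" "\<And>i. i \<in> I \<Longrightarrow> f i y > 1 - c i * \<delta> i"
    by (auto simp: I_def)
  \<comment> \<open>The midpoint between \<open>\<delta> i\<close> and the infimum of the parameters
    that are still admissible at \<open>y\<close>.\<close>
  define \<alpha> where "\<alpha> i = ((1 - f i y) / c i + \<delta> i) / 2" for i
  have \<alpha>: "0 < \<alpha> i \<and> \<alpha> i < \<delta> i \<and> f i y > 1 - c i * \<alpha> i" if "i \<in> I" for i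
  proof -
    have i: "0 < \<delta> i" "0 < c i" "f i \<in> dual_sphere" using *[of i] that by (auto simp: I_def)
    define q where "q = (1 - f i y) / c i"
    have "q < \<delta> i"
      using y(2)[OF that] i by (simp add: q_def field_simps)
    moreover have "0 \<le> q"
      using dual_sphereD(2)[OF i(3), of y] y(1) i by (simp add: q_def)
    moreover have "\<alpha> i = (q + \<delta> i) / 2" by (simp add: \<alpha>_def q_def)
    ultimately have a: "0 < \<alpha> i" "\<alpha> i < \<delta> i" "q < \<alpha> i"
      using i by simp_all
    from a(3) have "f i y > 1 - c i * \<alpha> i" using i by (simp add: q_def field_simps)
    with a show ?thesis by blast
  qed
  \<comment> \<open>The least gap over the finite nonempty \<open>I\<close>. Slices with parameter
    \<open>\<alpha> i + g\<close> then lie inside those with \<open>\<delta> i\<close>, to which the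
    diameter bound applies.\<close>
  define g where "g = Min ((\<lambda>i. \<delta> i - \<alpha> i) ` I)"
  have g_le: "\<alpha> i + g \<le> \<delta> i" if "i \<in> I" for i
  proof -
    have "g \<le> \<delta> i - \<alpha> i" unfolding g_def using that I by (intro Min_le) auto
    then show ?thesis by simp
  qed
  have 1: "0 < g" unfolding g_def using I \<alpha> by (subst Min_gr_iff) auto
  have 2: "g < 1"
  proof -
    obtain i where "i \<in> I" using I(2) by blast
    with g_le[of i] \<alpha>[of i] *[of i] show ?thesis by (auto simp: I_def)
  qed
  have 3: "f i \<in> dual_sphere \<and> 0 < \<alpha> i \<and> \<alpha> i < 1" if "i \<in> I" for i
    using *[of i] \<alpha>[of i] that by (auto simp: I_def)
  have 4: "\<exists>T\<in>isometry_group. \<forall>i\<in>I. f i (T x) > 1 - \<alpha> i" if "norm x = 1" for x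
    by (rule orbit_meets_slices[OF ct I, where c = c and y = y])
      (use 3 \<alpha> c y that in \<open>simp_all add: I_def\<close>)
  have 5: "norm (u - v) < \<epsilon>"
    if uv: "norm u \<le> 1" "norm v \<le> 1" "\<forall>i\<in>I. f i u > 1 - 2 * (\<alpha> i + g)"
      "\<forall>i\<in>I. f i v > 1 - 2 * (\<alpha> i + g)" for u v
  proof -
    let ?D = "{y::'a \<in> cball 0 1. \<forall>i\<in>{1..k}. f i y > 1 - 2 * \<delta> i}"
    have "1 - 2 * \<delta> i < f i u \<and> 1 - 2 * \<delta> i < f i v" if "i \<in> I" for i
      using g_le[OF that] bspec[OF uv(3) that] bspec[OF uv(4) that] by simp
    with uv have "u \<in> ?D" "v \<in> ?D" by (simp_all add: I_def)
    \<comment> \<open>\<open>diameter\<close> is a supremum, so it controls distances only for a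
      bounded set.\<close>
    moreover have "bounded ?D" by (rule bounded_subset[OF bounded_cball[of 0 1]]) auto
    ultimately have "dist u v \<le> diameter ?D" by (intro diameter_bounded_bound)
    with dm show ?thesis by (simp add: dist_norm)
  qed
  show "\<exists>(I::nat set) f \<alpha> g. 0 < g \<and> g < 1 \<and>
     (\<forall>i\<in>I. f i \<in> dual_sphere \<and> 0 < \<alpha> i \<and> \<alpha> i < 1) \<and>
     (\<forall>x. norm x = 1 \<longrightarrow> (\<exists>T\<in>isometry_group. \<forall>i\<in>I. f i (T x) > 1 - \<alpha> i)) \<and>
     (\<forall>u v::'a. norm u \<le> 1 \<longrightarrow> norm v \<le> 1 \<longrightarrow> (\<forall>i\<in>I. f i u > 1 - 2 * (\<alpha> i + g)) \<longrightarrow>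
        (\<forall>i\<in>I. f i v > 1 - 2 * (\<alpha> i + g)) \<longrightarrow> norm (u - v) < \<epsilon>)"
    by (intro exI[of _ I] exI[of _ f] exI[of _ \<alpha>] exI[of _ g] conjI allI impI 1 2 4 5) (use 3 in auto)
qed

section \<open>Almost transitivity\<close>

lemma slice_transitive_imp_almost_transitive:
  assumes "slice_transitive TYPE('a::real_normed_vector)"
  shows "almost_transitive TYPE('a)"
  unfolding almost_transitive_def
proof (intro allI impI equalityI)
  fix x :: 'a assume x: "norm x = 1"
  show "closure (orbit x) \<subseteq> sphere 0 1"
  proof (rule closure_minimal)
    have "closed {z::'a. norm z = 1}" by (intro closed_Collect_eq continuous_intros)
    then show "closed (sphere (0::'a) 1)" by (simp add: sphere_def)
  qed (auto simp: orbit_def x isometry_groupD(3))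
  show "sphere 0 1 \<subseteq> closure (orbit x)"
  proof
    fix y :: 'a assume "y \<in> sphere 0 1"
    then have y: "norm y = 1" by simp
    show "y \<in> closure (orbit x)"
      unfolding closure_approachable
    proof (intro allI impI)
      fix e :: real assume "0 < e"
      with assms obtain g I and f :: "nat \<Rightarrow> 'a \<Rightarrow> real" and \<alpha> where
        g: "0 < g" "g < 1"
        and \<alpha>': "\<forall>i\<in>I. f i \<in> dual_sphere \<and> 0 < \<alpha> i \<and> \<alpha> i < 1"
        and T': "\<forall>x. norm x = 1 \<longrightarrow> (\<exists>T\<in>isometry_group. \<forall>i\<in>I. f i (T x) > 1 - \<alpha> i)"
        and uv: "\<forall>u v. norm u \<le> 1 \<longrightarrow> norm v \<le> 1 \<longrightarrow>
          (\<forall>i\<in>I. f i u > 1 - 2 * (\<alpha> i + g)) \<longrightarrow>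
          (\<forall>i\<in>I. f i v > 1 - 2 * (\<alpha> i + g)) \<longrightarrow> norm (u - v) < e"
        by (rule slice_transitiveE)
      note \<alpha> = bspec[OF \<alpha>'] and T = T'[rule_format]
      from T[OF x] T[OF y] obtain T S where T: "T \<in> isometry_group" "\<forall>i\<in>I. f i (T x) > 1 - \<alpha> i"
        and S: "S \<in> isometry_group" "\<forall>i\<in>I. f i (S y) > 1 - \<alpha> i" by blast
      \<comment> \<open>Undoing \<open>S\<close> turns two nearby points of different orbits into a
        point of the orbit of \<open>x\<close> near \<open>y\<close>.\<close>
      obtain R where R: "R \<in> isometry_group" "\<And>x. R (S x) = x"
        using isometry_group_inverse[OF S(1)] by blast
      have "norm (T x - S y) < e"
      proof (rule uv[rule_format])
        have le: "1 - 2 * (\<alpha> i + g) \<le> 1 - \<alpha> i" if "i \<in> I" for i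
          using \<alpha>[OF that] g by simp
        show "f i (T x) > 1 - 2 * (\<alpha> i + g)" "f i (S y) > 1 - 2 * (\<alpha> i + g)" if "i \<in> I" for i
          using T(2) S(2) le[OF that] that by (blast intro: le_less_trans)+
      qed (use T(1) S(1) x y in \<open>simp_all add: isometry_groupD(3)\<close>)
      then have "norm (R (T x) - y) < e"
        using isometry_group_dist[OF R(1), of "T x" "S y"] R(2) by simp
      moreover have "R (T x) \<in> orbit x"
        using isometry_group_compose[OF R(1) T(1)] by (auto simp: orbit_def intro!: exI[of _ "R \<circ> T"])
      ultimately show "\<exists>z\<in>orbit x. dist z y < e" by (auto simp: dist_norm)
    qed
  qed
qed

section \<open>Uniform convexity\<close>

lemma slice_transitive_imp_uniformly_convex:
  assumes "slice_transitive TYPE('a::real_normed_vector)"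
  shows "uniformly_convex TYPE('a)"
  unfolding uniformly_convex_def
proof (intro allI impI)
  fix e :: real assume "0 < e"
  with assms obtain g I and f :: "nat \<Rightarrow> 'a \<Rightarrow> real" and \<alpha> where
    g: "0 < g" "g < 1"
    and \<alpha>': "\<forall>i\<in>I. f i \<in> dual_sphere \<and> 0 < \<alpha> i \<and> \<alpha> i < 1"
    and T': "\<forall>x. norm x = 1 \<longrightarrow> (\<exists>T\<in>isometry_group. \<forall>i\<in>I. f i (T x) > 1 - \<alpha> i)"
    and uv: "\<forall>u v. norm u \<le> 1 \<longrightarrow> norm v \<le> 1 \<longrightarrow>
          (\<forall>i\<in>I. f i u > 1 - 2 * (\<alpha> i + g)) \<longrightarrow>
          (\<forall>i\<in>I. f i v > 1 - 2 * (\<alpha> i + g)) \<longrightarrow> norm (u - v) < e"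
    by (rule slice_transitiveE)
  note \<alpha> = bspec[OF \<alpha>'] and T = T'[rule_format]
  have "norm ((x + y) /\<^sub>R 2) \<le> 1 - g" if xy: "norm x \<le> 1" "norm y \<le> 1" "norm (x - y) \<ge> e"
    for x y :: 'a
  proof (rule ccontr)
    define z where "z = (x + y) /\<^sub>R 2"
    define n where "n = norm z"
    assume "\<not> norm ((x + y) /\<^sub>R 2) \<le> 1 - g"
    then have n: "n > 1 - g" by (simp add: n_def z_def)
    with g have n0: "n > 0" by simp
    \<comment> \<open>Transitivity acts on unit vectors, so the midpoint is normalized first; as
      \<open>n > 1 - g\<close>, this costs at most \<open>g\<close> in each functional.\<close>
    then have "norm (z /\<^sub>R n) = 1" by (simp add: n_def)
    from T[OF this] obtain T where T: "T \<in> isometry_group"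
      "\<forall>i\<in>I. f i (T (z /\<^sub>R n)) > 1 - \<alpha> i" by blast
    note Tl = isometry_groupD(1)[OF T(1)]
    have "f i (T x) > 1 - 2 * (\<alpha> i + g) \<and> f i (T y) > 1 - 2 * (\<alpha> i + g)" if i: "i \<in> I" for i
    proof -
      have fl: "linear (f i)"
        using \<alpha>[OF i] dual_sphereD(1) bounded_linear.linear by blast
      \<comment> \<open>An endpoint value cannot exceed 1, so a midpoint value above
        \<open>1 - \<alpha> i - g\<close> forces the other endpoint above
        \<open>1 - 2 * (\<alpha> i + g)\<close>. This is where the factor 2 comes from.\<close>
      have le: "f i (T x) \<le> 1" "f i (T y) \<le> 1"
        using dual_sphereD(2)[of "f i" "T x"] dual_sphereD(2)[of "f i" "T y"] \<alpha>[OF i] xy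
        by (auto simp: isometry_groupD(3)[OF T(1)])
      have "f i (T (z /\<^sub>R n)) = f i (T z) / n"
        by (simp add: linear_scale[OF Tl] linear_scale[OF fl] divide_inverse mult.commute)
      then have "1 - \<alpha> i < f i (T z) / n"
        using T(2) i by metis
      then have "n * (1 - \<alpha> i) < f i (T z)" using n0 by (simp add: field_simps)
      moreover have "(1 - g) * (1 - \<alpha> i) \<le> n * (1 - \<alpha> i)"
        using n \<alpha>[OF i] by (intro mult_right_mono) auto
      moreover have "1 - \<alpha> i - g \<le> (1 - g) * (1 - \<alpha> i)"
        using g \<alpha>[OF i] by (simp add: algebra_simps)
      moreover have "f i (T z) = (f i (T x) + f i (T y)) / 2"
        by (simp add: z_def linear_scale[OF Tl] linear_scale[OF fl] linear_add[OF Tl] linear_add[OF fl])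
      ultimately show ?thesis using le by argo
    qed
    then have "norm (T x - T y) < e"
      using xy by (intro uv[rule_format]) (simp_all add: isometry_groupD(3)[OF T(1)])
    with xy show False by (simp add: isometry_group_dist[OF T(1)])
  qed
  with g show "\<exists>\<delta>>0. \<forall>x y::'a. norm x \<le> 1 \<longrightarrow> norm y \<le> 1 \<longrightarrow>
      norm (x - y) \<ge> e \<longrightarrow> norm ((x + y) /\<^sub>R 2) \<le> 1 - \<delta>" by blast
qed

section \<open>A quadratic inequality from uniform convexity\<close>

text \<open>A substitute for the parallelogram law, quadratic so that it can be averaged over random
  walks. The bracket is positive only for vectors far apart relative to their size, which is where
  uniform convexity gives a gain.\<close>

lemma uniformly_convex_square_ineq:
  assumes "uniformly_convex TYPE('a::real_normed_vector)"
  obtains \<gamma> :: real where "0 < \<gamma>" "\<gamma> \<le> 1"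
    "\<And>x y::'a. (norm (x + y))\<^sup>2 \<le> 2 * ((norm x)\<^sup>2 + (norm y)\<^sup>2)
       - \<gamma> * ((norm (x - y))\<^sup>2 - ((norm x)\<^sup>2 + (norm y)\<^sup>2) / 4)"
proof -
  obtain \<delta>0 :: real where "0 < \<delta>0"
    and uc0: "\<And>x y::'a. \<lbrakk>norm x \<le> 1; norm y \<le> 1; norm (x - y) \<ge> 1/2\<rbrakk> \<Longrightarrow>
      norm ((x + y) /\<^sub>R 2) \<le> 1 - \<delta>0"
    using assms[unfolded uniformly_convex_def, rule_format, of "1/2"] by auto
  \<comment> \<open>Capping at 1 keeps \<open>1 - \<delta>\<close> nonnegative, which allows
    squaring, and makes the square of \<open>\<delta>\<close> at most
    \<open>\<delta>\<close>.\<close>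
  define \<delta> where "\<delta> = min \<delta>0 1"
  have \<delta>: "0 < \<delta>" "\<delta> \<le> 1" using \<open>0 < \<delta>0\<close> by (auto simp: \<delta>_def)
  have uc: "norm (x + y) \<le> 2 * m * (1 - \<delta>)"
    if m: "0 < m" "norm x \<le> m" "norm y \<le> m" "norm (x - y) \<ge> m / 2" for x y :: 'a and m
  proof -
    have "norm ((x /\<^sub>R m + y /\<^sub>R m) /\<^sub>R 2) \<le> 1 - \<delta>0"
    proof (rule uc0)
      have "norm (x /\<^sub>R m - y /\<^sub>R m) = norm (x - y) / m"
        using m(1) by (simp add: divide_inverse mult.commute flip: scaleR_diff_right)
      then show "1/2 \<le> norm (x /\<^sub>R m - y /\<^sub>R m)" using m by (simp only: le_divide_eq) simp
    qed (use m in \<open>simp_all add: field_simps\<close>)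
    also have "(x /\<^sub>R m + y /\<^sub>R m) /\<^sub>R 2 = (x + y) /\<^sub>R (2 * m)"
      by (simp add: scaleR_add_right)
    also have "norm \<dots> = norm (x + y) / (2 * m)"
      unfolding norm_scaleR using m(1) by (simp add: divide_simps)
    finally have "norm (x + y) \<le> 2 * m * (1 - \<delta>0)"
      using m(1) by (simp add: field_simps)
    also have "\<dots> \<le> 2 * m * (1 - \<delta>)"
      using m(1) by (intro mult_left_mono) (auto simp: \<delta>_def)
    finally show ?thesis .
  qed
  \<comment> \<open>Small enough for both sources of gain in \<open>far\<close>: clearly different
    norms contribute a term of order \<open>\<delta>\<^sup>2\<close>, nearly equal norms a factor
    \<open>1 - \<delta>\<close>.\<close>
  define \<gamma> where "\<gamma> = \<delta>\<^sup>2 / 4"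
  have "\<delta>\<^sup>2 \<le> \<delta>" using \<delta> by (simp add: power2_eq_square mult_left_le)
  then have \<gamma>: "0 < \<gamma>" "\<gamma> \<le> \<delta>" "\<gamma> \<le> 1" using \<delta> by (simp_all add: \<gamma>_def)
  have far: "(norm (x + y))\<^sup>2 \<le> 2 * (1 - \<gamma>) * ((norm x)\<^sup>2 + (norm y)\<^sup>2)"
    if le: "norm y \<le> norm x" and xy: "norm (x - y) \<ge> norm x / 2" for x y :: 'a
  proof (cases "x = 0")
    case True
    with le show ?thesis by simp
  next
    case False
    define m s where "m = norm x" and "s = norm y"
    have m: "0 < m" "0 \<le> s" "s \<le> m" using False le by (auto simp: m_def s_def)
    show ?thesis
    proof (cases "s < m * (1 - \<delta>)")
      \<comment> \<open>The norms differ by at least \<open>\<delta> * m\<close>, so the triangle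
        inequality alone already saves \<open>(m - s)\<^sup>2\<close>.\<close>
      case True
      then have "\<delta> * m \<le> m - s" by (simp add: algebra_simps)
      then have "(\<delta> * m)\<^sup>2 \<le> (m - s)\<^sup>2" using \<delta> m by (intro power_mono) auto
      moreover have "s\<^sup>2 \<le> m\<^sup>2" using m by (intro power_mono) auto
      then have "\<delta>\<^sup>2 * (m\<^sup>2 + s\<^sup>2) \<le> 2 * (\<delta> * m)\<^sup>2"
        by (simp add: power_mult_distrib algebra_simps mult_left_mono)
      moreover have "(norm (x + y))\<^sup>2 \<le> (m + s)\<^sup>2"
        by (intro power_mono) (auto simp: m_def s_def norm_triangle_ineq)
      moreover have "(m + s)\<^sup>2 = 2 * (m\<^sup>2 + s\<^sup>2) - (m - s)\<^sup>2"
        by (simp add: power2_eq_square algebra_simps)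
      ultimately show ?thesis unfolding m_def[symmetric] s_def[symmetric] \<gamma>_def
        by (simp add: algebra_simps)
    next
      case False
      \<comment> \<open>Uniform convexity gives a factor \<open>1 - \<delta>\<close>. After
        squaring, one such factor is kept as the gain and the other absorbs the difference between
        \<open>s\<close> and \<open>m\<close>.\<close>
      have "norm (x + y) \<le> 2 * m * (1 - \<delta>)"
        using m le xy by (intro uc) (auto simp: m_def)
      then have "(norm (x + y))\<^sup>2 \<le> (2 * m * (1 - \<delta>))\<^sup>2"
        by (intro power_mono) auto
      also have "\<dots> = 2 * (1 - \<delta>) * (2 * m\<^sup>2 * (1 - \<delta>))"
        by (simp add: power2_eq_square)
      also have "\<dots> \<le> 2 * (1 - \<delta>) * (m\<^sup>2 + s\<^sup>2)"
      proof (rule mult_left_mono)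
        have "(m * (1 - \<delta>))\<^sup>2 \<le> s\<^sup>2" using False \<delta> m by (intro power_mono) auto
        moreover have "m\<^sup>2 + (m * (1 - \<delta>))\<^sup>2 = 2 * m\<^sup>2 * (1 - \<delta>) + (m * \<delta>)\<^sup>2"
          by (simp add: power2_eq_square algebra_simps)
        ultimately show "2 * m\<^sup>2 * (1 - \<delta>) \<le> m\<^sup>2 + s\<^sup>2" by (smt (verit) zero_le_power2)
      qed (use \<delta> in auto)
      also have "\<dots> \<le> 2 * (1 - \<gamma>) * (m\<^sup>2 + s\<^sup>2)"
        using \<gamma> by (intro mult_right_mono) auto
      finally show ?thesis by (simp add: m_def s_def)
    qed
  qed
  have "(norm (x + y))\<^sup>2 \<le> 2 * ((norm x)\<^sup>2 + (norm y)\<^sup>2)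
       - \<gamma> * ((norm (x - y))\<^sup>2 - ((norm x)\<^sup>2 + (norm y)\<^sup>2) / 4)" for x y :: 'a
  proof -
    define S where "S = (norm x)\<^sup>2 + (norm y)\<^sup>2"
    have sq: "(norm x + norm y)\<^sup>2 \<le> 2 * S"
      using zero_le_power2[of "norm x - norm y"] by (simp add: S_def power2_eq_square algebra_simps)
    have sum: "(norm (x + y))\<^sup>2 \<le> 2 * S"
      by (rule order_trans[OF power_mono[OF norm_triangle_ineq norm_ge_zero] sq])
    have diff: "(norm (x - y))\<^sup>2 \<le> 2 * S"
      by (rule order_trans[OF power_mono[OF norm_triangle_ineq4 norm_ge_zero] sq])
    show ?thesis unfolding S_def[symmetric]
    \<comment> \<open>Nearby vectors make the bracket nonpositive and need only the triangle
      inequality. For the others \<open>far\<close> saves \<open>2 * \<gamma> * S\<close>, enough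
      because \<open>(norm (x - y))\<^sup>2\<close> is at most \<open>2 * S\<close>.\<close>
    proof (cases "(norm (x - y))\<^sup>2 \<le> S / 4")
      case True
      then have "\<gamma> * ((norm (x - y))\<^sup>2 - S / 4) \<le> 0"
        using \<gamma> by (intro mult_nonneg_nonpos) auto
      with sum show "(norm (x + y))\<^sup>2 \<le> 2 * S - \<gamma> * ((norm (x - y))\<^sup>2 - S / 4)" by simp
    next
      case False
      have "(norm x)\<^sup>2 / 4 \<le> (norm (x - y))\<^sup>2 \<and> (norm y)\<^sup>2 / 4 \<le> (norm (x - y))\<^sup>2"
      proof -
        have "(norm x)\<^sup>2 / 4 \<le> S / 4" "(norm y)\<^sup>2 / 4 \<le> S / 4"
          by (simp_all add: S_def divide_right_mono)
        with False show ?thesis by linarith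
      qed
      then have half: "norm x / 2 \<le> norm (x - y)" "norm y / 2 \<le> norm (x - y)"
        using power2_le_imp_le[of "norm x / 2" "norm (x - y)"]
          power2_le_imp_le[of "norm y / 2" "norm (x - y)"]
        by (simp_all only: power_divide power2_eq_square[of 2] norm_ge_zero) simp_all
      have "(norm (x + y))\<^sup>2 \<le> 2 * (1 - \<gamma>) * S"
      proof (cases "norm y \<le> norm x")
        case True
        then show ?thesis using far[OF True half(1)] by (simp only: S_def)
      next
        case False
        then have "norm x \<le> norm y" by simp
        moreover have "norm y / 2 \<le> norm (y - x)" using half(2) by (simp only: norm_minus_commute)
        ultimately have "(norm (y + x))\<^sup>2 \<le> 2 * (1 - \<gamma>) * ((norm y)\<^sup>2 + (norm x)\<^sup>2)" by (rule far)
        then show ?thesis by (simp only: S_def add.commute)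
      qed
      moreover have "\<gamma> * (norm (x - y))\<^sup>2 \<le> \<gamma> * (2 * S)"
        using diff \<gamma> by (intro mult_left_mono) auto
      moreover have "0 \<le> \<gamma> * S" using \<gamma> by (simp add: S_def)
      ultimately show "(norm (x + y))\<^sup>2 \<le> 2 * S - \<gamma> * ((norm (x - y))\<^sup>2 - S / 4)"
        by (simp add: algebra_simps)
    qed
  qed
  with \<gamma> that show thesis by blast
qed

section \<open>Dyadic averages and martingales\<close>

text \<open>Expectation over \<open>n\<close> independent fair signs. The head of the list is
  averaged out first, so each recursion step is a conditional expectation given the tail.\<close>

primrec dyadic_avg :: "nat \<Rightarrow> (bool list \<Rightarrow> 'b::real_vector) \<Rightarrow> 'b" where
  "dyadic_avg 0 F = F []"
| "dyadic_avg (Suc n) F = dyadic_avg n (\<lambda>w. (F (True # w) + F (False # w)) /\<^sub>R 2)"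

lemma dyadic_avg_const [simp]: "dyadic_avg n (\<lambda>_. a) = a"
  by (induction n) (simp_all flip: scaleR_2)

lemma dyadic_avg_add:
  "dyadic_avg n (\<lambda>w. F w + G w) = dyadic_avg n F + dyadic_avg n G"
proof (induction n arbitrary: F G)
  case (Suc n)
  show ?case
    by (simp add: Suc.IH[symmetric]) (simp add: algebra_simps)
qed simp

lemma dyadic_avg_scaleR:
  "dyadic_avg n (\<lambda>w. c *\<^sub>R F w) = c *\<^sub>R dyadic_avg n F"
proof (induction n arbitrary: F)
  case (Suc n)
  show ?case
    by (simp add: Suc.IH[symmetric]) (simp add: algebra_simps)
qed simp

lemma dyadic_avg_mult:
  "dyadic_avg n (\<lambda>w. c * F w) = c * dyadic_avg n F" for c :: real
  using dyadic_avg_scaleR[of n c F] by simp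

lemma dyadic_avg_diff:
  "dyadic_avg n (\<lambda>w. F w - G w) = dyadic_avg n F - dyadic_avg n G"
  using dyadic_avg_add[of n "\<lambda>w. F w - G w" G] by simp

lemma dyadic_avg_mono:
  fixes F G :: "bool list \<Rightarrow> real"
  assumes "\<And>w. F w \<le> G w"
  shows "dyadic_avg n F \<le> dyadic_avg n G"
  using assms by (induction n arbitrary: F G) (simp_all add: add_mono)

text \<open>The tower property: \<open>u\<close> holds the older signs, and the inner average is
  conditional on them.\<close>

lemma dyadic_avg_append:
  "dyadic_avg (n + m) F = dyadic_avg n (\<lambda>u. dyadic_avg m (\<lambda>v. F (v @ u)))"
  by (induction m arbitrary: F) simp_all

lemma power2_norm_midpoint_le:
  "(norm ((x + y) /\<^sub>R 2))\<^sup>2 \<le> ((norm x)\<^sup>2 + (norm y)\<^sup>2) /\<^sub>R 2"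
  for x y :: "'a::real_normed_vector"
proof -
  have "(norm (x + y))\<^sup>2 \<le> (norm x + norm y)\<^sup>2"
    by (intro power_mono norm_triangle_ineq) simp
  also have "\<dots> \<le> 2 * ((norm x)\<^sup>2 + (norm y)\<^sup>2)"
    using zero_le_power2[of "norm x - norm y"] by (simp add: power2_eq_square algebra_simps)
  finally show ?thesis by (simp add: power_mult_distrib power2_eq_square)
qed

text \<open>Jensen's inequality for the squared norm, from its midpoint convexity one sign at a
  time.\<close>

lemma power2_norm_dyadic_avg_le:
  fixes F :: "bool list \<Rightarrow> 'a::real_normed_vector"
  shows "(norm (dyadic_avg n F))\<^sup>2 \<le> dyadic_avg n (\<lambda>w. (norm (F w))\<^sup>2)"
proof (induction n arbitrary: F)
  case (Suc n)
  have "(norm (dyadic_avg (Suc n) F))\<^sup>2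
      \<le> dyadic_avg n (\<lambda>w. (norm ((F (True # w) + F (False # w)) /\<^sub>R 2))\<^sup>2)"
    unfolding dyadic_avg.simps by (rule Suc.IH)
  also have "\<dots> \<le> dyadic_avg (Suc n) (\<lambda>w. (norm (F w))\<^sup>2)"
    unfolding dyadic_avg.simps by (rule dyadic_avg_mono power2_norm_midpoint_le)+
  finally show ?case .
qed simp

text \<open>The most recent sign is the head of the list.\<close>
primrec walk :: "(bool list \<Rightarrow> 'a::real_vector) \<Rightarrow> bool list \<Rightarrow> 'a" where
  "walk d [] = 0"
| "walk d (b # w) = walk d w + (if b then d w else - d w)"

text \<open>After the history \<open>u\<close> the walk restarts with steps that still depend on
  \<open>u\<close>, so a bound valid for all step functions covers the second piece as well.\<close>

lemma walk_append: "walk d (v @ u) = walk d u + walk (\<lambda>w. d (w @ u)) v"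
  by (induction v) simp_all

text \<open>The martingale property: the last step takes opposite values under the two
  signs.\<close>

lemma dyadic_avg_walk [simp]: "dyadic_avg n (walk d) = 0"
  by (induction n) (simp_all flip: scaleR_2)

text \<open>Convexity alone would give the factor 4; the gain comes from applying
  \<open>ineq\<close> to the two halves. The assumption on \<open>b\<close> ranges over all step
  functions because the second half has steps of its own.\<close>

lemma dyadic_avg_walk_double:
  fixes d :: "bool list \<Rightarrow> 'a::real_normed_vector"
  assumes \<gamma>: "0 < \<gamma>" "\<gamma> \<le> 1"
    and ineq: "\<And>x y::'a. (norm (x + y))\<^sup>2 \<le> 2 * ((norm x)\<^sup>2 + (norm y)\<^sup>2)
       - \<gamma> * ((norm (x - y))\<^sup>2 - ((norm x)\<^sup>2 + (norm y)\<^sup>2) / 4)"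
    and b: "\<And>d::bool list \<Rightarrow> 'a. (\<And>w. norm (d w) \<le> 1) \<Longrightarrow> dyadic_avg n (\<lambda>w. (norm (walk d w))\<^sup>2) \<le> b"
    and d: "\<And>w. norm (d w) \<le> 1"
  shows "dyadic_avg (n + n) (\<lambda>w. (norm (walk d w))\<^sup>2) \<le> (4 - \<gamma> / 2) * b"
proof -
  have inner: "dyadic_avg n (\<lambda>v. (norm (walk d (v @ u)))\<^sup>2)
      \<le> (2 - 3 / 4 * \<gamma>) * (norm (walk d u))\<^sup>2 + (2 + \<gamma> / 4) * b" for u
  proof -
    define x where "x = walk d u"
    define y where "y = walk (\<lambda>w. d (w @ u))"
    define A where "A = dyadic_avg n (\<lambda>v. (norm (y v))\<^sup>2)"
    define D where "D = dyadic_avg n (\<lambda>v. (norm (x - y v))\<^sup>2)"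
    \<comment> \<open>Given the first half, \<open>x - y v\<close> has mean \<open>x\<close>, so
      Jensen bounds its second moment from below by \<open>(norm x)\<^sup>2\<close>.\<close>
    have "(norm (dyadic_avg n (\<lambda>v. x - y v)))\<^sup>2 \<le> D"
      unfolding D_def by (rule power2_norm_dyadic_avg_le)
    then have xD: "(norm x)\<^sup>2 \<le> D"
      by (simp add: dyadic_avg_diff y_def)
    have Ab: "A \<le> b" unfolding A_def y_def using d by (intro b) auto
    have "dyadic_avg n (\<lambda>v. (norm (walk d (v @ u)))\<^sup>2) = dyadic_avg n (\<lambda>v. (norm (x + y v))\<^sup>2)"
      by (simp add: walk_append x_def y_def)
    also have "\<dots> \<le> dyadic_avg n (\<lambda>v. ((2 + \<gamma> / 4) * (norm x)\<^sup>2 + (2 + \<gamma> / 4) * (norm (y v))\<^sup>2)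
        - \<gamma> * (norm (x - y v))\<^sup>2)"
      by (rule dyadic_avg_mono, rule order_trans[OF ineq]) (simp add: algebra_simps)
    also have "\<dots> = (2 + \<gamma> / 4) * (norm x)\<^sup>2 + (2 + \<gamma> / 4) * A - \<gamma> * D"
      by (simp only: dyadic_avg_diff dyadic_avg_add dyadic_avg_mult dyadic_avg_const A_def D_def)
    also have "\<dots> \<le> (2 + \<gamma> / 4) * (norm x)\<^sup>2 + (2 + \<gamma> / 4) * b - \<gamma> * (norm x)\<^sup>2"
      using \<gamma> xD Ab by (intro diff_mono add_left_mono mult_left_mono) auto
    finally show ?thesis by (simp add: x_def algebra_simps)
  qed
  have "dyadic_avg (n + n) (\<lambda>w. (norm (walk d w))\<^sup>2)
      \<le> dyadic_avg n (\<lambda>u. (2 - 3 / 4 * \<gamma>) * (norm (walk d u))\<^sup>2 + (2 + \<gamma> / 4) * b)"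
    unfolding dyadic_avg_append by (rule dyadic_avg_mono) (rule inner)
  also have "\<dots> = (2 - 3 / 4 * \<gamma>) * dyadic_avg n (\<lambda>u. (norm (walk d u))\<^sup>2) + (2 + \<gamma> / 4) * b"
    by (simp only: dyadic_avg_add dyadic_avg_mult dyadic_avg_const)
  \<comment> \<open>The first coefficient is nonnegative since \<open>\<gamma> \<le> 1\<close>; the
    two add up to \<open>4 - \<gamma> / 2\<close>.\<close>
  also have "\<dots> \<le> (2 - 3 / 4 * \<gamma>) * b + (2 + \<gamma> / 4) * b"
    using \<gamma> b[OF d] by (intro add_right_mono mult_left_mono) auto
  finally show ?thesis by (simp add: algebra_simps)
qed

text \<open>Repeated doubling from a single step. The base is below 4, so the growth is subquadratic
  in the length \<open>2 ^ k\<close>.\<close>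

lemma dyadic_avg_walk_le:
  fixes d :: "bool list \<Rightarrow> 'a::real_normed_vector"
  assumes \<gamma>: "0 < \<gamma>" "\<gamma> \<le> 1"
    and ineq: "\<And>x y::'a. (norm (x + y))\<^sup>2 \<le> 2 * ((norm x)\<^sup>2 + (norm y)\<^sup>2)
       - \<gamma> * ((norm (x - y))\<^sup>2 - ((norm x)\<^sup>2 + (norm y)\<^sup>2) / 4)"
    and d: "\<And>w. norm (d w) \<le> 1"
  shows "dyadic_avg (2 ^ k) (\<lambda>w. (norm (walk d w))\<^sup>2) \<le> (4 - \<gamma> / 2) ^ k"
  using d
proof (induction k arbitrary: d)
  case 0
  have "(norm (d []))\<^sup>2 \<le> 1" using 0[of "[]"] by (simp add: power_le_one)
  then show ?case by simp
next
  case (Suc k)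
  have "dyadic_avg (2 ^ k + 2 ^ k) (\<lambda>w. (norm (walk d w))\<^sup>2) \<le> (4 - \<gamma> / 2) * (4 - \<gamma> / 2) ^ k"
    using Suc by (intro dyadic_avg_walk_double[OF \<gamma> ineq]) auto
  then show ?case by (simp add: mult_2)
qed

text \<open>Otherwise one could always step so that the norm grows by \<open>c\<close> on average; after
  \<open>2 ^ k\<close> steps the second moment would be at least \<open>c\<^sup>2 4 ^ k\<close>.\<close>
lemma uniformly_convex_not_rough:
  assumes uc: "uniformly_convex TYPE('a::real_normed_vector)" and "0 < c"
  shows "\<exists>x::'a. \<forall>y. norm y \<le> 1 \<longrightarrow> (norm (x + y) + norm (x - y)) / 2 < norm x + c"
proof (rule ccontr)
  assume "\<not> ?thesis"
  then have "\<forall>x::'a. \<exists>y. norm y \<le> 1 \<and> norm x + c \<le> (norm (x + y) + norm (x - y)) / 2"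
    by (meson not_less)
  then obtain Y :: "'a \<Rightarrow> 'a" where Y: "\<And>x. norm (Y x) \<le> 1"
    "\<And>x. norm x + c \<le> (norm (x + Y x) + norm (x - Y x)) / 2" by metis
  \<comment> \<open>The step depends on the current position, so the position is defined first, by
    recursion along the signs; \<open>d\<close> reads it off and \<open>walk d\<close> recovers
    it.\<close>
  define W where "W = rec_list 0 (\<lambda>b w m. m + (if b then Y m else - Y m))"
  define d where "d w = Y (W w)" for w
  have W: "walk d w = W w" for w
    by (induction w) (simp_all add: W_def d_def)
  have lower: "c * n \<le> dyadic_avg n (\<lambda>w. norm (W w))" for n
  proof (induction n)
    case (Suc n)
    have "c * Suc n \<le> dyadic_avg n (\<lambda>w. norm (W w) + c)"
      using Suc by (simp add: dyadic_avg_add algebra_simps)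
    also have "\<dots> \<le> dyadic_avg (Suc n) (\<lambda>w. norm (W w))"
      unfolding dyadic_avg.simps using Y(2)
      by (intro dyadic_avg_mono) (simp add: W_def)
    finally show ?case .
  qed (simp add: W_def)
  obtain \<gamma> :: real where \<gamma>: "0 < \<gamma>" "\<gamma> \<le> 1"
    and ineq: "\<And>x y::'a. (norm (x + y))\<^sup>2 \<le> 2 * ((norm x)\<^sup>2 + (norm y)\<^sup>2)
       - \<gamma> * ((norm (x - y))\<^sup>2 - ((norm x)\<^sup>2 + (norm y)\<^sup>2) / 4)"
    using uniformly_convex_square_ineq[OF uc] by metis
  \<comment> \<open>Jensen sets the linear lower bound against the second moment bound; dividing by
    \<open>4 ^ k\<close> leaves a base below 1.\<close>
  have "c\<^sup>2 \<le> (1 - \<gamma> / 8) ^ k" for k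
  proof -
    have "c\<^sup>2 * 4 ^ k = (c * real (2 ^ k))\<^sup>2"
      by (simp add: power2_eq_square mult_ac flip: power_mult_distrib)
    also have "\<dots> \<le> (dyadic_avg (2 ^ k) (\<lambda>w. norm (W w)))\<^sup>2"
      using lower[of "2 ^ k"] \<open>0 < c\<close> by (intro power_mono) auto
    also have "\<dots> \<le> dyadic_avg (2 ^ k) (\<lambda>w. (norm (W w))\<^sup>2)"
      using power2_norm_dyadic_avg_le[of "2 ^ k" "\<lambda>w. norm (W w)"] by simp
    also have "\<dots> \<le> (4 - \<gamma> / 2) ^ k"
      using dyadic_avg_walk_le[OF \<gamma> ineq, of d k] Y(1) by (simp add: W d_def)
    also have "\<dots> = (1 - \<gamma> / 8) ^ k * 4 ^ k" by (simp flip: power_mult_distrib)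
    finally show ?thesis by simp
  qed
  moreover obtain k where "(1 - \<gamma> / 8) ^ k < c\<^sup>2"
    using real_arch_pow_inv[of "c\<^sup>2" "1 - \<gamma> / 8"] \<gamma> \<open>0 < c\<close> by auto
  ultimately show False by (meson not_le)
qed

section \<open>Uniform smoothness\<close>

text \<open>A bound uniform over pairs of unit vectors passes to the supremum in
  \<open>modulus_smoothness\<close>; the nonzero vector makes the set of pairs nonempty.\<close>

lemma uniformly_smoothI:
  assumes "e \<noteq> (0::'a::real_normed_vector)"
    and flat: "\<And>c. 0 < c \<Longrightarrow> \<exists>t0>0. \<forall>t x y. 0 < t \<longrightarrow> t \<le> t0 \<longrightarrow> norm x = 1 \<longrightarrow> norm (y::'a) = 1 \<longrightarrow>
      (norm (x + t *\<^sub>R y) + norm (x - t *\<^sub>R y)) / 2 \<le> 1 + c * t"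
  shows "uniformly_smooth TYPE('a)"
  unfolding uniformly_smooth_def
proof (rule tendstoI)
  fix r :: real assume "0 < r"
  define c where "c = r / 2"
  have c: "0 < c" "c < r" using \<open>0 < r\<close> by (auto simp: c_def)
  from flat[OF c(1)] obtain t0 where "0 < t0" and
    t0: "\<And>t x y. \<lbrakk>0 < t; t \<le> t0; norm x = 1; norm (y::'a) = 1\<rbrakk> \<Longrightarrow>
      (norm (x + t *\<^sub>R y) + norm (x - t *\<^sub>R y)) / 2 \<le> 1 + c * t" by blast
  define u where "u = e /\<^sub>R norm e"
  have u: "norm u = 1" using assms(1) by (simp add: u_def)
  have "dist (modulus_smoothness TYPE('a) t / t) 0 < r" if t: "0 < t" "t < t0" for t
  proof -
    let ?P = "{(x::'a, y). norm x = 1 \<and> norm y = 1}"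
    let ?g = "\<lambda>p::'a \<times> 'a. (norm (fst p + t *\<^sub>R snd p) + norm (fst p - t *\<^sub>R snd p)) / 2 - 1"
    have le: "?g p \<le> c * t" if "p \<in> ?P" for p
    proof -
      have "norm (fst p) = 1" "norm (snd p) = 1" using that by auto
      from t0[OF t(1) less_imp_le[OF t(2)] this] show ?thesis by linarith
    qed
    have uP: "(u, u) \<in> ?P" using u by simp
    have bdd: "bdd_above (?g ` ?P)" using le by (auto intro!: bdd_aboveI2)
    \<comment> \<open>Testing with the pair \<open>(u, u)\<close> shows that the modulus is
      nonnegative, so only the upper bound matters for the limit.\<close>
    have "norm ((u + t *\<^sub>R u) + (u - t *\<^sub>R u)) \<le> norm (u + t *\<^sub>R u) + norm (u - t *\<^sub>R u)"
      by (rule norm_triangle_ineq)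
    moreover have "(u + t *\<^sub>R u) + (u - t *\<^sub>R u) = 2 *\<^sub>R u" by (simp add: scaleR_2)
    ultimately have "0 \<le> ?g (u, u)" using u by simp
    then have "0 \<le> modulus_smoothness TYPE('a) t"
      unfolding modulus_smoothness_def using cSUP_upper[OF uP bdd] by linarith
    moreover have "modulus_smoothness TYPE('a) t \<le> c * t"
      unfolding modulus_smoothness_def using uP le by (intro cSUP_least) auto
    moreover have "c * t < r * t" using c t by simp
    ultimately have "0 \<le> modulus_smoothness TYPE('a) t \<and> modulus_smoothness TYPE('a) t < r * t"
      by linarith
    then show ?thesis using t by (simp add: pos_divide_less_eq)
  qed
  then show "\<forall>\<^sub>F t in at_right 0. dist (modulus_smoothness TYPE('a) t / t) 0 < r"
    using \<open>0 < t0\<close> unfolding eventually_at_right_field by blast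
qed

text \<open>An isometry brings \<open>x0\<close> close to \<open>x\<close>. Since the bound at
  \<open>x0\<close> holds in all unit directions, it covers the direction pulled back from
  \<open>y\<close>.\<close>

lemma almost_transitive_flat:
  fixes x0 x y :: "'a::real_normed_vector"
  assumes at: "almost_transitive TYPE('a)"
    and x0: "norm x0 = 1" "\<And>y. norm y = 1 \<Longrightarrow> norm (x0 + t *\<^sub>R y) + norm (x0 - t *\<^sub>R y) \<le> M"
    and x: "norm x = 1" and y: "norm y = 1"
  shows "norm (x + t *\<^sub>R y) + norm (x - t *\<^sub>R y) \<le> M"
proof (rule field_le_epsilon)
  fix e :: real assume "0 < e"
  have "x \<in> closure (orbit x0)" using at x x0(1) by (simp add: almost_transitive_def)
  \<comment> \<open>The error \<open>e / 2\<close> enters once in each of the two norms.\<close>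
  then obtain z where "z \<in> orbit x0" "dist z x < e / 2"
    using \<open>0 < e\<close> unfolding closure_approachable by (meson half_gt_zero)
  then obtain T where T: "T \<in> isometry_group" "norm (x - T x0) < e / 2"
    by (auto simp: orbit_def dist_norm norm_minus_commute)
  obtain S where S: "S \<in> isometry_group" "\<And>x. T (S x) = x"
    using isometry_group_inverse[OF T(1)] by blast
  note Tl = isometry_groupD(1)[OF T(1)]
  have eq: "norm (T x0 + r *\<^sub>R y) = norm (x0 + r *\<^sub>R S y)" for r
    using isometry_groupD(3)[OF T(1), of "x0 + r *\<^sub>R S y"]
    by (simp add: linear_add[OF Tl] linear_scale[OF Tl] S(2))
  have "norm (x + r *\<^sub>R y) \<le> norm (T x0 + r *\<^sub>R y) + norm (x - T x0)" for r
    using norm_triangle_ineq[of "T x0 + r *\<^sub>R y" "x - T x0"] by (simp add: algebra_simps)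
  from this[of t] this[of "- t"] x0(2)[of "S y"] eq[of t] eq[of "- t"] T(2)
  show "norm (x + t *\<^sub>R y) + norm (x - t *\<^sub>R y) \<le> M + e"
    using isometry_groupD(3)[OF S(1), of y] y by simp
qed

text \<open>By convexity of the norm, the symmetric difference quotient does not increase when the
  step shrinks.\<close>

lemma norm_symmetric_step_le:
  fixes x y :: "'a::real_normed_vector"
  assumes t: "0 < t" "t \<le> t0" and x: "norm x = 1"
    and le: "(norm (x + t0 *\<^sub>R y) + norm (x - t0 *\<^sub>R y)) / 2 \<le> 1 + c * t0"
  shows "(norm (x + t *\<^sub>R y) + norm (x - t *\<^sub>R y)) / 2 \<le> 1 + c * t"
proof -
  define s where "s = t / t0"
  have s: "0 \<le> s" "s \<le> 1" "s * t0 = t" using t by (auto simp: s_def)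
  have conv: "norm (x + r *\<^sub>R (s *\<^sub>R y)) \<le> (1 - s) + s * norm (x + r *\<^sub>R y)" for r
  proof -
    have "x + r *\<^sub>R (s *\<^sub>R y) = (1 - s) *\<^sub>R x + s *\<^sub>R (x + r *\<^sub>R y)"
      by (simp add: algebra_simps)
    also have "norm \<dots> \<le> norm ((1 - s) *\<^sub>R x) + norm (s *\<^sub>R (x + r *\<^sub>R y))"
      by (rule norm_triangle_ineq)
    finally show ?thesis using s x by simp
  qed
  have "norm (x + t *\<^sub>R y) + norm (x - t *\<^sub>R y)
      \<le> 2 * (1 - s) + s * (norm (x + t0 *\<^sub>R y) + norm (x - t0 *\<^sub>R y))"
    using conv[of t0] conv[of "- t0"] s(3) by (simp add: mult.commute algebra_simps)
  also have "\<dots> \<le> 2 * (1 - s) + s * (2 * (1 + c * t0))"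
    using le s by (intro add_left_mono mult_left_mono) auto
  also have "\<dots> = 2 * (1 + c * t)" using s(3) by (auto simp: algebra_simps)
  finally show ?thesis by simp
qed

lemma almost_transitive_imp_uniformly_smooth:
  assumes e: "e \<noteq> (0::'a::real_normed_vector)"
    and at: "almost_transitive TYPE('a)" and uc: "uniformly_convex TYPE('a)"
  shows "uniformly_smooth TYPE('a)"
proof (rule uniformly_smoothI[OF e])
  fix c :: real assume c: "0 < c"
  \<comment> \<open>With \<open>c'\<close> at most 1 the point \<open>z\<close> cannot be 0, where
    every unit step raises the norm by exactly 1.\<close>
  define c' where "c' = min c 1"
  have c': "0 < c'" "c' \<le> c" "c' \<le> 1" using c by (auto simp: c'_def)
  obtain z :: 'a where
    z: "\<And>y. norm y \<le> 1 \<Longrightarrow> (norm (z + y) + norm (z - y)) / 2 < norm z + c'"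
    using uniformly_convex_not_rough[OF uc c'(1)] by blast
  have "z \<noteq> 0"
    using z[of "e /\<^sub>R norm e"] e c' by auto
  \<comment> \<open>Scaling \<open>z\<close> to the unit sphere turns its unit steps into steps of
    length \<open>t0\<close>.\<close>
  define t0 x0 where "t0 = 1 / norm z" and "x0 = t0 *\<^sub>R z"
  have t0: "0 < t0" "t0 * norm z = 1" "norm x0 = 1" using \<open>z \<noteq> 0\<close> by (auto simp: t0_def x0_def)
  have x0: "norm (x0 + t0 *\<^sub>R y) + norm (x0 - t0 *\<^sub>R y) \<le> 2 * (1 + c * t0)" if "norm y = 1" for y
  proof -
    have "norm (x0 + t0 *\<^sub>R y) + norm (x0 - t0 *\<^sub>R y) = t0 * (norm (z + y) + norm (z - y))"
      using t0(1) by (simp add: x0_def distrib_left flip: scaleR_add_right scaleR_diff_right)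
    also have "\<dots> \<le> t0 * (2 * (norm z + c))"
      using z[of y] that t0(1) c'(2) by (intro mult_left_mono) auto
    also have "\<dots> = 2 * (t0 * norm z + c * t0)" by (simp add: algebra_simps)
    finally show ?thesis using t0(2) by simp
  qed
  show "\<exists>t0>0. \<forall>t x y. 0 < t \<longrightarrow> t \<le> t0 \<longrightarrow> norm x = 1 \<longrightarrow> norm (y::'a) = 1 \<longrightarrow>
      (norm (x + t *\<^sub>R y) + norm (x - t *\<^sub>R y)) / 2 \<le> 1 + c * t"
  proof (intro exI[of _ t0] conjI allI impI t0(1))
    fix t :: real and x y :: 'a
    assume t: "0 < t" "t \<le> t0" and xy: "norm x = 1" "norm y = 1"
    show "(norm (x + t *\<^sub>R y) + norm (x - t *\<^sub>R y)) / 2 \<le> 1 + c * t"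
      using almost_transitive_flat[OF at t0(3) x0 xy]
      by (intro norm_symmetric_step_le[OF t xy(1)]) simp
  qed
qed

theorem theorem4:
  assumes "convex_transitive TYPE('a::banach)"
    and "\<forall>\<epsilon>>0. \<exists>(k::nat) (\<delta>::nat \<Rightarrow> real) (c::nat \<Rightarrow> real) (f::nat \<Rightarrow> 'a \<Rightarrow> real).
           (\<forall>i\<in>{1..k}. 0 < \<delta> i \<and> \<delta> i < 1 \<and> 0 < c i \<and> c i \<le> 1 \<and> f i \<in> dual_sphere) \<and>
           (\<Sum>i\<in>{1..k}. c i) = 1 \<and>
           {y \<in> cball 0 1. \<forall>i\<in>{1..k}. f i y > 1 - c i * \<delta> i} \<noteq> {} \<and>
           diameter {y \<in> cball 0 1. \<forall>i\<in>{1..k}. f i y > 1 - 2 * \<delta> i} < \<epsilon>"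
  shows "class_J TYPE('a)"
proof -
  have st: "slice_transitive TYPE('a)" by (rule convex_transitive_imp_slice_transitive[OF assms])
  have at: "almost_transitive TYPE('a)" and uc: "uniformly_convex TYPE('a)"
    using st by (rule slice_transitive_imp_almost_transitive, rule slice_transitive_imp_uniformly_convex)
  \<comment> \<open>A functional of norm one, available because weights with sum 1 need an index,
    excludes the zero space; the smoothness argument asks for a nonzero vector.\<close>
  obtain f :: "'a \<Rightarrow> real" where "f \<in> dual_sphere"
  proof -
    obtain k :: nat and c :: "nat \<Rightarrow> real" and f :: "nat \<Rightarrow> 'a \<Rightarrow> real"
      where "\<forall>i\<in>{1..k}. f i \<in> dual_sphere" "(\<Sum>i\<in>{1..k}. c i) = 1"
      using assms(2)[rule_format, of 1] by auto
    moreover from this(2) have "k \<noteq> 0" by (cases "k = 0") auto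
    ultimately show thesis using that[of "f 1"] by simp
  qed
  have "\<exists>e::'a. e \<noteq> 0"
  proof (rule ccontr)
    assume "\<not> ?thesis"
    then have "f = (\<lambda>_. 0)"
      using \<open>f \<in> dual_sphere\<close> by (metis bounded_linear.linear dual_sphereD(1) linear_0 ext)
    then show False using \<open>f \<in> dual_sphere\<close> by (simp add: dual_sphere_def onorm_zero)
  qed
  with at uc show ?thesis
    unfolding class_J_def using almost_transitive_imp_uniformly_smooth by blast
qed

end
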